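(* Let $T$ be a hyperbolic rational map of degree at least $2$ with Julia set $\mathcal{J}$, regarded as a map $T:\mathcal{J}\to\mathcal{J}$, and let $\mu$ be a non-atomic $T$-invariant Borel probability measure on $\mathcal{J}$. Then for $\mu$-a.e. $z\in\mathcal{J}$, 1. $\underline{R}(z)\le \underline{d}_{\mu}(z)$; 2. $\overline{R}(z)\le \overline{d}_{\mu}(z)$.
   Context: The Julia set $\mathcal{J}\subset\overline{\mathbb{C}}$ of a rational map $T$ is the closure of the set of repelling periodic points of $T$; it is compact and $T^{-1}(\mathcal{J})=\mathcal{J}$. $T$ is hyperbolic if there exist $C>0$ and $\lambda>1$ with $|(T^n)'(z)|\ge C\lambda^n$ for all $z\in\mathcal{J}$, $n\ge1$. Distances on $\mathcal{J}$ are written $|z-w|$ (Euclidean distance when $\mathcal{J}\subset\mathbb{C}$; if $\infty\in\mathcal{J}$, use the chordal distance and the corresponding derivative). $N_r(z)=\{w\in\mathcal{J}:|z-w|<r\}$ is the open ball in $\mathcal{J}$ of radius $r>0$ about $z$. $\mathbb{Z}_+$ is the set of positive integers. Recurrence time: $\tau_r(z)=\inf\{n\in\mathbb{Z}_+: T^n(z)\in N_r(z)\}$ ($=\infty$ if there is no such $n$). Lower and upper recurrence rates: $$\underline{R}(z)=\liminf_{r\to0}\frac{\log\tau_r(z)}{-\log r},\qquad \overline{R}(z)=\limsup_{r\to0}\frac{\log\tau_r(z)}{-\log r}.$$ Lower and upper local dimensions: $$\underline{d}_\mu(z)=\liminf_{r\to0}\frac{\log\mu(N_r(z))}{\log r},\qquad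 \overline{d}_\mu(z)=\limsup_{r\to0}\frac{\log\mu(N_r(z))}{\log r}.$$ *)

theory Defs
  imports "HOL-Probability.Probability" "HOL-Computational_Algebra.Computational_Algebra"
begin

datatype sphere = Fin complex | Infty

text \<open>Junk value \<^term>\<open>0\<close> at \<^term>\<open>Infty\<close>; only ever relevant where the argument is finite.\<close>

fun to_complex :: "sphere \<Rightarrow> complex" where
  "to_complex (Fin z) = z"
| "to_complex Infty = 0"

fun chordal :: "sphere \<Rightarrow> sphere \<Rightarrow> real" where
  "chordal (Fin z) (Fin w) =
     2 * cmod (z - w) / (sqrt (1 + (cmod z)\<^sup>2) * sqrt (1 + (cmod w)\<^sup>2))"
| "chordal (Fin z) Infty = 2 / sqrt (1 + (cmod z)\<^sup>2)"
| "chordal Infty (Fin w) = 2 / sqrt (1 + (cmod w)\<^sup>2)"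
| "chordal Infty Infty = 0"

fun stereo :: "sphere \<Rightarrow> complex \<times> real" where
  "stereo (Fin z) = (of_real (2 / (1 + (cmod z)\<^sup>2)) * z, ((cmod z)\<^sup>2 - 1) / ((cmod z)\<^sup>2 + 1))"
| "stereo Infty = (0, 1)"

lemma chordal_stereo: "chordal x y = dist (stereo x) (stereo y)"
proof -
  have fin_inf: "dist (stereo (Fin z)) (stereo Infty) = 2 / sqrt (1 + (cmod z)\<^sup>2)" for z
  proof -
    define a where "a = (cmod z)\<^sup>2"
    have a: "a \<ge> 0" by (simp add: a_def)
    have "(dist (stereo (Fin z)) (stereo Infty))\<^sup>2 =
        (2 / (1 + a) * cmod z)\<^sup>2 + ((a - 1) / (a + 1) - 1)\<^sup>2"
      using a by (simp add: dist_prod_def dist_norm norm_mult norm_divide a_def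
          del: of_real_add of_real_divide)
    also have "\<dots> = 4 * a / (1 + a)\<^sup>2 + ((a - 1) / (a + 1) - 1)\<^sup>2"
      by (simp add: power_mult_distrib power_divide a_def)
    also have "\<dots> = 4 / (1 + a)"
    proof -
      have "(a - 1) / (a + 1) - 1 = - 2 / (1 + a)" using a by (simp add: field_simps)
      then have "4 * a / (1 + a)\<^sup>2 + ((a - 1) / (a + 1) - 1)\<^sup>2 = (4 * a + 4) / (1 + a)\<^sup>2"
        by (simp add: power_divide add_divide_distrib)
      also have "\<dots> = 4 / (1 + a)" proof -
        have "1 + a \<noteq> 0" using a by simp
        moreover have "(4 * a + 4) / (1 + a)\<^sup>2 = 4 * (1 + a) / ((1 + a) * (1 + a))"
          by (simp add: power2_eq_square)
        ultimately show ?thesis by (metis mult_divide_mult_cancel_right)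
      qed
      finally show ?thesis .
    qed
    also have "\<dots> = (2 / sqrt (1 + a))\<^sup>2" using a by (simp add: power_divide)
    finally show ?thesis using a
      by (metis a_def divide_nonneg_nonneg power2_eq_iff_nonneg real_sqrt_ge_zero zero_le_dist
          zero_le_numeral add_nonneg_nonneg zero_le_one)
  qed
  have fin_fin: "dist (stereo (Fin z)) (stereo (Fin w)) =
      2 * cmod (z - w) / (sqrt (1 + (cmod z)\<^sup>2) * sqrt (1 + (cmod w)\<^sup>2))" for z w
  proof -
    define a b where "a = (cmod z)\<^sup>2" and "b = (cmod w)\<^sup>2"
    have a: "a \<ge> 0" and b: "b \<ge> 0" by (simp_all add: a_def b_def)
    define c where "c = z \<bullet> w"
    have zz: "z \<bullet> z = a" and ww: "w \<bullet> w = b" and wz: "w \<bullet> z = c"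
      by (simp_all add: a_def b_def c_def power2_norm_eq_inner inner_commute)
    define s t where "s = 2 / (1 + a)" and "t = 2 / (1 + b)"
    have st: "s * (1 + a) = 2" "t * (1 + b) = 2"
      unfolding s_def t_def times_divide_eq_left
      by (rule nonzero_mult_div_cancel_right, use a b in simp)+
    have pa: "(a - 1) / (a + 1) = 1 - s" "(b - 1) / (b + 1) = 1 - t"
      using a b by (simp_all add: s_def t_def field_simps)
    have "(dist (stereo (Fin z)) (stereo (Fin w)))\<^sup>2 =
        (cmod (s *\<^sub>R z - t *\<^sub>R w))\<^sup>2 + ((1 - s) - (1 - t))\<^sup>2"
      unfolding stereo.simps a_def[symmetric] b_def[symmetric] pa s_def[symmetric] t_def[symmetric]
      by (simp add: dist_prod_def dist_norm scaleR_conv_of_real)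
    also have "\<dots> = s\<^sup>2 * a - 2 * s * t * c + t\<^sup>2 * b + (t - s)\<^sup>2"
      unfolding power2_norm_eq_inner
      by (simp add: inner_diff_left inner_diff_right zz ww wz c_def[symmetric]
          power2_eq_square algebra_simps)
    also have "\<dots> = s * (s * (1 + a)) + t * (t * (1 + b)) - 2 * s * t - 2 * s * t * c"
      by (simp add: power2_eq_square algebra_simps)
    also have "\<dots> = 2 * s + 2 * t - 2 * s * t - 2 * s * t * c"
      unfolding st by simp
    also have "\<dots> = s * (t * (1 + b)) + t * (s * (1 + a)) - 2 * s * t - 2 * s * t * c"
      unfolding st by simp
    also have "\<dots> = s * t * (a - 2 * c + b)" by (simp add: algebra_simps)
    also have "a - 2 * c + b = (cmod (z - w))\<^sup>2"
      unfolding power2_norm_eq_inner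
      by (simp add: inner_diff_left inner_diff_right zz ww wz c_def[symmetric])
    also have "s * t * (cmod (z - w))\<^sup>2 = (2 * cmod (z - w) / (sqrt (1 + a) * sqrt (1 + b)))\<^sup>2"
      using a b by (simp add: s_def t_def power_divide power_mult_distrib)
    finally have eq: "(dist (stereo (Fin z)) (stereo (Fin w)))\<^sup>2 =
        (2 * cmod (z - w) / (sqrt (1 + a) * sqrt (1 + b)))\<^sup>2" .
    have nn: "0 \<le> 2 * cmod (z - w) / (sqrt (1 + a) * sqrt (1 + b))"
      using a b by simp
    show ?thesis
      using eq nn power2_eq_iff_nonneg[OF zero_le_dist nn] unfolding a_def b_def by blast
  qed
  show ?thesis
  proof (cases x)
    case (Fin z)
    then show ?thesis using fin_fin fin_inf by (cases y) (simp_all del: stereo.simps)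
  next
    case Infty
    then show ?thesis using fin_inf
      by (cases y) (simp_all only: chordal.simps dist_self, metis dist_commute)
  qed
qed

lemma chordal_eq_0: "chordal x y = 0 \<longleftrightarrow> x = y"
  by (cases x; cases y) (simp_all add: add_nonneg_eq_0_iff)

instantiation sphere :: metric_space
begin

definition dist_sphere :: "sphere \<Rightarrow> sphere \<Rightarrow> real" where
  "dist_sphere = chordal"

definition uniformity_sphere :: "(sphere \<times> sphere) filter" where
  "uniformity_sphere = (INF e\<in>{0 <..}. principal {(x, y). dist x y < e})"

definition open_sphere :: "sphere set \<Rightarrow> bool" where
  "open_sphere U \<longleftrightarrow> (\<forall>x\<in>U. eventually (\<lambda>(x', y). x' = x \<longrightarrow> y \<in> U) uniformity)"

instance
proof
  show "dist x y = 0 \<longleftrightarrow> x = y" for x y :: sphere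
    by (simp add: dist_sphere_def chordal_eq_0)
  show "dist x y \<le> dist x z + dist y z" for x y z :: sphere
    by (simp add: dist_sphere_def chordal_stereo dist_triangle2)
qed (simp_all add: uniformity_sphere_def open_sphere_def)

end

text \<open>For coprime \<^term>\<open>p\<close>, \<^term>\<open>q\<close>, the value at \<^term>\<open>Infty\<close> compares the
  coefficients in degree \<^term>\<open>max (degree p) (degree q)\<close>.\<close>

fun rat_eval :: "complex poly \<Rightarrow> complex poly \<Rightarrow> sphere \<Rightarrow> sphere" where
  "rat_eval p q (Fin z) = (if poly q z = 0 then Infty else Fin (poly p z / poly q z))"
| "rat_eval p q Infty =
     (let n = max (degree p) (degree q)
      in if coeff q n = 0 then Infty else Fin (coeff p n / coeff q n))"

definition rational_map :: "nat \<Rightarrow> (sphere \<Rightarrow> sphere) \<Rightarrow> bool" where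
  "rational_map d T \<longleftrightarrow>
     (\<exists>p q. q \<noteq> 0 \<and> coprime p q \<and> max (degree p) (degree q) = d \<and> T = rat_eval p q)"

fun inv_sphere :: "sphere \<Rightarrow> sphere" where
  "inv_sphere (Fin z) = (if z = 0 then Infty else Fin (1 / z))"
| "inv_sphere Infty = Fin 0"

text \<open>The multiplier at a fixed point; at \<^term>\<open>Infty\<close> it is computed in the coordinate
  \<open>1 / z\<close>.\<close>

definition multiplier :: "(sphere \<Rightarrow> sphere) \<Rightarrow> sphere \<Rightarrow> complex" where
  "multiplier f z =
     (case z of
        Fin a \<Rightarrow> deriv (\<lambda>w. to_complex (f (Fin w))) a
      | Infty \<Rightarrow> deriv (\<lambda>w. to_complex (inv_sphere (f (inv_sphere (Fin w))))) 0)"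

definition repelling_periodic :: "(sphere \<Rightarrow> sphere) \<Rightarrow> sphere \<Rightarrow> bool" where
  "repelling_periodic T z \<longleftrightarrow>
     (\<exists>n>0. (T ^^ n) z = z \<and> cmod (multiplier (T ^^ n) z) > 1)"

definition julia :: "(sphere \<Rightarrow> sphere) \<Rightarrow> sphere set" where
  "julia T = closure {z. repelling_periodic T z}"

definition chordal_deriv :: "(sphere \<Rightarrow> sphere) \<Rightarrow> sphere \<Rightarrow> real" where
  "chordal_deriv f z = Lim (at z) (\<lambda>w. chordal (f w) (f z) / chordal w z)"

text \<open>Modulus of the derivative and distance on \<^term>\<open>J\<close>: Euclidean when \<^term>\<open>J\<close> lies in
  the plane, chordal otherwise. In the Euclidean case they are meant for points of \<^term>\<open>J\<close>
  that \<^term>\<open>f\<close> maps into \<^term>\<open>J\<close>.\<close>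

definition deriv_abs :: "sphere set \<Rightarrow> (sphere \<Rightarrow> sphere) \<Rightarrow> sphere \<Rightarrow> real" where
  "deriv_abs J f z =
     (if Infty \<in> J then chordal_deriv f z
      else cmod (deriv (\<lambda>w. to_complex (f (Fin w))) (to_complex z)))"

definition dist_on :: "sphere set \<Rightarrow> sphere \<Rightarrow> sphere \<Rightarrow> real" where
  "dist_on J z w = (if Infty \<in> J then chordal z w else cmod (to_complex z - to_complex w))"

definition hyperbolic :: "(sphere \<Rightarrow> sphere) \<Rightarrow> bool" where
  "hyperbolic T \<longleftrightarrow>
     (\<exists>C>0. \<exists>l>1. \<forall>z\<in>julia T. \<forall>n\<ge>1. deriv_abs (julia T) (T ^^ n) z \<ge> C * l ^ n)"

definition nbhd :: "sphere set \<Rightarrow> real \<Rightarrow> sphere \<Rightarrow> sphere set" where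
  "nbhd J r z = {w \<in> J. dist_on J z w < r}"

definition nonatomic :: "'a measure \<Rightarrow> bool" where
  "nonatomic M \<longleftrightarrow>
     (\<forall>A\<in>sets M. emeasure M A > 0 \<longrightarrow>
        (\<exists>B\<in>sets M. B \<subseteq> A \<and> 0 < emeasure M B \<and> emeasure M B < emeasure M A))"

definition invariant_measure :: "('a \<Rightarrow> 'a) \<Rightarrow> 'a measure \<Rightarrow> bool" where
  "invariant_measure T M \<longleftrightarrow> T \<in> M \<rightarrow>\<^sub>M M \<and> distr M M T = M"

definition ln_ext :: "ereal \<Rightarrow> ereal" where
  "ln_ext x =
     (if x \<le> 0 then -\<infinity> else if x = \<infinity> then \<infinity> else ereal (ln (real_of_ereal x)))"

text \<open>The infimum of the empty set in \<^typ>\<open>enat\<close> is \<open>\<infinity>\<close>.\<close>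

definition recurrence_time :: "(sphere \<Rightarrow> sphere) \<Rightarrow> real \<Rightarrow> sphere \<Rightarrow> enat" where
  "recurrence_time T r z = Inf {enat n | n. n > 0 \<and> (T ^^ n) z \<in> nbhd (julia T) r z}"

definition lower_recurrence_rate :: "(sphere \<Rightarrow> sphere) \<Rightarrow> sphere \<Rightarrow> ereal" where
  "lower_recurrence_rate T z =
     Liminf (at_right 0) (\<lambda>r. ln_ext (ereal_of_enat (recurrence_time T r z)) / ereal (- ln r))"

definition upper_recurrence_rate :: "(sphere \<Rightarrow> sphere) \<Rightarrow> sphere \<Rightarrow> ereal" where
  "upper_recurrence_rate T z =
     Limsup (at_right 0) (\<lambda>r. ln_ext (ereal_of_enat (recurrence_time T r z)) / ereal (- ln r))"

definition lower_local_dim :: "sphere set \<Rightarrow> sphere measure \<Rightarrow> sphere \<Rightarrow> ereal" where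
  "lower_local_dim J M z =
     Liminf (at_right 0) (\<lambda>r. ln_ext (ereal (measure M (nbhd J r z))) / ereal (ln r))"

definition upper_local_dim :: "sphere set \<Rightarrow> sphere measure \<Rightarrow> sphere \<Rightarrow> ereal" where
  "upper_local_dim J M z =
     Limsup (at_right 0) (\<lambda>r. ln_ext (ereal (measure M (nbhd J r z))) / ereal (ln r))"

end

(* The argument is that of Barreira and Saussol. For an invariant probability measure, the points
   of a set A that do not return to A before time n form a set of measure at most 1 / n. Embed the
   Julia set into three-dimensional space and apply this to the 3 x 3 x 3 block A of cubes of side
   r = 2^-n around each cube Q of a grid. A ball of radius r about a point of Q lies in A, and each
   point lies in only 27 blocks. So, outside a set of measure O(r^e), a point z returns to its ball
   of radius 8 r at a time k with k * mu(B(z, r)) <= r^-e. These measures are summable in n, and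
   Borel-Cantelli gives both inequalities. *)

theory Submission
  imports Defs
begin

section \<open>Return times of a measure-preserving map\<close>

context prob_space
begin

lemma measurable_funpow:
  assumes "T \<in> M \<rightarrow>\<^sub>M M"
  shows "(T ^^ n) \<in> M \<rightarrow>\<^sub>M M"
  using assms by (induction n) (auto intro: measurable_comp)

lemma prob_vimage_funpow:
  assumes T: "T \<in> M \<rightarrow>\<^sub>M M" and inv: "distr M M T = M" and E: "E \<in> events"
  shows "prob ((T ^^ n) -` E \<inter> space M) = prob E"
proof -
  have "distr M M (T ^^ n) = M"
  proof (induction n)
    case 0
    show ?case by (simp add: distr_id[unfolded id_def] id_def)
  next
    case (Suc n)
    have "distr M M (T ^^ Suc n) = distr (distr M M (T ^^ n)) M T"
      using distr_distr[OF T measurable_funpow[OF T, of n]] by simp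
    with Suc inv show ?case by (simp only:)
  qed
  then show ?thesis
    using measure_distr[OF measurable_funpow[OF T, of n] E] by simp
qed

lemma sets_no_return:
  fixes n :: nat
  assumes T: "T \<in> M \<rightarrow>\<^sub>M M" and Q: "Q \<in> events" and A: "A \<in> events"
  shows "{x\<in>Q. \<forall>k. 0 < k \<and> k < n \<longrightarrow> (T ^^ k) x \<notin> A} \<in> events"
proof -
  have "{x\<in>Q. \<forall>k. 0 < k \<and> k < n \<longrightarrow> (T ^^ k) x \<notin> A} =
      Q - (\<Union>k\<in>{0<..<n}. (T ^^ k) -` A \<inter> space M)"
    using sets.sets_into_space[OF Q] by auto
  also have "\<dots> \<in> events"
    using measurable_sets[OF measurable_funpow[OF T] A]
    by (intro sets.Diff Q sets.finite_UN) auto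
  finally show ?thesis .
qed

text \<open>The points of \<^term>\<open>A\<close> that stay away from \<^term>\<open>A\<close> up to time \<^term>\<open>n\<close> have
  \<^term>\<open>n\<close> pairwise disjoint preimages of equal measure.\<close>

lemma return_time_tail:
  fixes n :: nat
  assumes T: "T \<in> M \<rightarrow>\<^sub>M M" and inv: "distr M M T = M" and A: "A \<in> events"
  shows "n * prob {x\<in>A. \<forall>k. 0 < k \<and> k < n \<longrightarrow> (T ^^ k) x \<notin> A} \<le> 1"
proof -
  define E where "E = {x\<in>A. \<forall>k. 0 < k \<and> k < n \<longrightarrow> (T ^^ k) x \<notin> A}"
  define P where "P = (\<lambda>i. (T ^^ i) -` E \<inter> space M)"
  have E: "E \<in> events" unfolding E_def by (rule sets_no_return[OF T A A])
  have P: "P i \<in> events" for i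
    unfolding P_def by (rule measurable_sets[OF measurable_funpow[OF T] E])
  \<comment> \<open>For a common point \<open>x\<close>, both \<open>(T ^^ i) x\<close> and
    \<open>(T ^^ j) x\<close> lie in \<open>E\<close>. So \<open>(T ^^ i) x\<close>, a point of
    \<open>E\<close>, is back in \<open>A\<close> after \<open>j - i\<close> steps, a positive time
    below \<open>n\<close>, which the definition of \<open>E\<close> forbids.\<close>
  have disj: "P i \<inter> P j = {}" if "i < j" "j < n" for i j
  proof -
    have "(T ^^ (j - i)) ((T ^^ i) x) = (T ^^ j) x" for x
      using that by (simp flip: funpow_add[THEN fun_cong, unfolded o_def])
    then show ?thesis
      using that unfolding P_def E_def by (auto dest!: spec[of _ "j - i"])
  qed
  have "disjoint_family_on P {..<n}"
    unfolding disjoint_family_on_def using disj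
    by (metis inf_commute lessThan_iff linorder_neqE_nat)
  then have "prob (\<Union>i<n. P i) = (\<Sum>i<n. prob (P i))"
    using P by (intro finite_measure_finite_Union) auto
  also have "\<dots> = n * prob E"
    unfolding P_def by (simp add: prob_vimage_funpow[OF T inv E])
  finally show ?thesis unfolding E_def by (metis prob_le_1)
qed

text \<open>Bounds the overlap of the blocks. For a fixed offset \<open>v\<close> the events
  \<open>K y = i + v\<close> are disjoint for distinct \<open>i\<close>, so each offset contributes
  at most 1 to the sum.\<close>

lemma sum_prob_translates_le:
  fixes K :: "'a \<Rightarrow> 'k::ab_group_add"
  assumes K: "K \<in> M \<rightarrow>\<^sub>M count_space UNIV" and F: "finite F" and V: "finite V"
  shows "(\<Sum>i\<in>F. prob {y\<in>space M. K y - i \<in> V}) \<le> card V"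
proof -
  have ev: "{y\<in>space M. P (K y)} \<in> events" for P
    using measurable_sets[OF K, of "Collect P"] by (simp add: vimage_def Int_def conj_commute)
  have "(\<Sum>i\<in>F. prob {y\<in>space M. K y - i \<in> V}) \<le>
      (\<Sum>i\<in>F. \<Sum>v\<in>V. prob {y\<in>space M. K y = i + v})"
  proof (rule sum_mono)
    fix i
    have "{y\<in>space M. K y - i \<in> V} = (\<Union>v\<in>V. {y\<in>space M. K y = i + v})"
      by (auto simp: algebra_simps)
    moreover have "(\<lambda>v. {y\<in>space M. K y = i + v}) ` V \<subseteq> events" using ev by (intro image_subsetI)
    ultimately show "prob {y\<in>space M. K y - i \<in> V} \<le> (\<Sum>v\<in>V. prob {y\<in>space M. K y = i + v})"
      using finite_measure_subadditive_finite[OF V] by simp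
  qed
  also have "\<dots> = (\<Sum>v\<in>V. \<Sum>i\<in>F. prob {y\<in>space M. K y = i + v})"
    by (rule sum.swap)
  also have "\<dots> \<le> (\<Sum>v\<in>V. 1)"
  proof (rule sum_mono)
    fix v
    have "(\<Sum>i\<in>F. prob {y\<in>space M. K y = i + v}) = prob (\<Union>i\<in>F. {y\<in>space M. K y = i + v})"
      using F ev by (intro finite_measure_finite_Union[symmetric]) (auto simp: disjoint_family_on_def)
    then show "(\<Sum>i\<in>F. prob {y\<in>space M. K y = i + v}) \<le> 1" by simp
  qed
  finally show ?thesis by simp
qed

text \<open>Here \<^term>\<open>K\<close> labels the cells of a partition and \<^term>\<open>V\<close> is the set of label
  differences of adjacent cells.\<close>

lemma quick_return_outside_small_set:
  fixes K :: "'a \<Rightarrow> 'k::ab_group_add" and t :: real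
  assumes T: "T \<in> M \<rightarrow>\<^sub>M M" and inv: "distr M M T = M"
    and K: "K \<in> M \<rightarrow>\<^sub>M count_space UNIV" and fin: "finite (K ` space M)"
    and V: "finite V" "0 \<in> V" and t: "t > 0"
  obtains B where "B \<in> events" "prob B \<le> card V / t"
    "\<And>x. x \<in> space M - B \<Longrightarrow>
      \<exists>k>0. K ((T ^^ k) x) - K x \<in> V \<and> k * prob {y\<in>space M. K y - K x \<in> V} \<le> t"
proof -
  define A where "A i = {y\<in>space M. K y - i \<in> V}" for i
  \<comment> \<open>By the return time bound, the points of \<open>A i\<close> that need
    \<open>N i\<close> steps or more have measure at most \<open>prob (A i) / t\<close>. If
    \<open>prob (A i) = 0\<close>, then \<open>t / 0 = 0\<close> gives \<open>N i = 0\<close> and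
    \<open>E i\<close> is the whole cell, which is a null set.\<close>
  define N where "N i = nat \<lceil>t / prob (A i)\<rceil>" for i
  define Q where "Q i = {y\<in>space M. K y = i}" for i
  define E where "E i = {x\<in>Q i. \<forall>k. 0 < k \<and> k < N i \<longrightarrow> (T ^^ k) x \<notin> A i}" for i
  define B where "B = (\<Union>i\<in>K ` space M. E i)"
  have ev: "{y\<in>space M. P (K y)} \<in> events" for P
    using measurable_sets[OF K, of "Collect P"] by (simp add: vimage_def Int_def conj_commute)
  have A: "A i \<in> events" for i unfolding A_def by (rule ev)
  have Q: "Q i \<in> events" for i unfolding Q_def by (rule ev)
  have E: "E i \<in> events" for i unfolding E_def by (rule sets_no_return[OF T Q A])
  have QA: "Q i \<subseteq> A i" for i using V by (auto simp: Q_def A_def)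
  have E_le: "prob (E i) \<le> prob (A i) / t" for i
  proof (cases "prob (A i) = 0")
    case True
    have "prob (E i) \<le> prob (A i)"
      using QA by (intro finite_measure_mono A) (auto simp: E_def)
    with True show ?thesis by simp
  next
    case False
    then have pos: "prob (A i) > 0" by (simp add: zero_less_measure_iff)
    \<comment> \<open>Since \<open>0 \<in> V\<close>, the cell \<open>Q i\<close> lies in
      \<open>A i\<close>, so its slow points are among those of \<open>A i\<close>, to which the
      return time bound applies.\<close>
    have "prob (E i) \<le> prob {x\<in>A i. \<forall>k. 0 < k \<and> k < N i \<longrightarrow> (T ^^ k) x \<notin> A i}"
      using QA by (intro finite_measure_mono sets_no_return[OF T A A]) (auto simp: E_def)
    then have "t / prob (A i) * prob (E i) \<le>
        N i * prob {x\<in>A i. \<forall>k. 0 < k \<and> k < N i \<longrightarrow> (T ^^ k) x \<notin> A i}"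
      using real_nat_ceiling_ge[of "t / prob (A i)"] unfolding N_def by (intro mult_mono) simp_all
    also have "\<dots> \<le> 1" by (rule return_time_tail[OF T inv A])
    finally show ?thesis using t pos by (simp add: field_simps)
  qed
  have "prob B \<le> (\<Sum>i\<in>K ` space M. prob (E i))"
    unfolding B_def using fin E by (intro finite_measure_subadditive_finite) auto
  also have "\<dots> \<le> (\<Sum>i\<in>K ` space M. prob (A i) / t)"
    by (intro sum_mono E_le)
  also have "\<dots> = (\<Sum>i\<in>K ` space M. prob (A i)) / t"
    by (simp add: sum_divide_distrib)
  also have "\<dots> \<le> card V / t"
    using t sum_prob_translates_le[OF K fin V(1)] unfolding A_def by (intro divide_right_mono) auto
  finally have B_le: "prob B \<le> card V / t" .
  have "\<exists>k>0. K ((T ^^ k) x) - K x \<in> V \<and> k * prob {y\<in>space M. K y - K x \<in> V} \<le> t"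
    if x: "x \<in> space M - B" for x
  proof -
    from x have "x \<notin> E (K x)" "x \<in> Q (K x)" by (auto simp: B_def Q_def)
    then obtain k where k: "0 < k" "k < N (K x)" "(T ^^ k) x \<in> A (K x)"
      by (auto simp: E_def)
    from k(2) have "real k < t / prob (A (K x))"
      unfolding N_def by linarith
    \<comment> \<open>Measure zero would make \<open>N (K x)\<close> zero, which contradicts
      \<open>k < N (K x)\<close>.\<close>
    moreover have "prob (A (K x)) > 0"
      using k(2) unfolding N_def by (cases "prob (A (K x)) = 0") (auto simp: zero_less_measure_iff)
    ultimately have "k * prob (A (K x)) \<le> t" by (simp add: field_simps)
    with k show ?thesis unfolding A_def by auto
  qed
  then show ?thesis
    using that[of B] B_le E fin unfolding B_def by (meson sets.finite_UN)
qed

end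

section \<open>A cubical grid in three-dimensional space\<close>

text \<open>Cubes are labelled by integer triples because these form a group: whether two cubes
  touch depends only on the difference of their labels.\<close>

definition grid_cell :: "real \<Rightarrow> complex \<times> real \<Rightarrow> int \<times> int \<times> int" where
  "grid_cell r p = (\<lfloor>Re (fst p) / r\<rfloor>, \<lfloor>Im (fst p) / r\<rfloor>, \<lfloor>snd p / r\<rfloor>)"

text \<open>The 27 offsets of a block, with zero for its central cube.\<close>

definition adjacent :: "(int \<times> int \<times> int) set" where
  "adjacent = {-1..1} \<times> {-1..1} \<times> {-1..1}"

lemma finite_adjacent: "finite adjacent" and zero_in_adjacent: "0 \<in> adjacent"
  by (auto simp: adjacent_def zero_prod_def)

lemma measurable_grid_cell: "grid_cell r \<in> borel \<rightarrow>\<^sub>M count_space UNIV"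
proof -
  have [measurable]: "fst \<in> borel_measurable (borel :: (complex \<times> real) measure)"
    "snd \<in> borel_measurable (borel :: (complex \<times> real) measure)"
    by (auto intro!: borel_measurable_continuous_onI continuous_intros)
  have "(\<lambda>p. (\<lfloor>Re (fst p) / r\<rfloor>, \<lfloor>Im (fst p) / r\<rfloor>, \<lfloor>snd p / r\<rfloor>))
      \<in> (borel :: (complex \<times> real) measure) \<rightarrow>\<^sub>M count_space UNIV \<Otimes>\<^sub>M (count_space UNIV \<Otimes>\<^sub>M count_space UNIV)"
    by measurable
  then show ?thesis
    by (simp add: grid_cell_def[abs_def] pair_measure_countable)
qed

lemma coordinate_diff_le_dist:
  fixes p q :: "complex \<times> real"
  shows "\<bar>Re (fst p) - Re (fst q)\<bar> \<le> dist p q"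
    "\<bar>Im (fst p) - Im (fst q)\<bar> \<le> dist p q" "\<bar>snd p - snd q\<bar> \<le> dist p q"
  using dist_fst_le[of p q] dist_snd_le[of p q]
    abs_Re_le_cmod[of "fst p - fst q"] abs_Im_le_cmod[of "fst p - fst q"]
  by (auto simp: dist_norm)

lemma dist_le_coordinate_diffs:
  fixes p q :: "complex \<times> real"
  shows "dist p q \<le> \<bar>Re (fst p) - Re (fst q)\<bar> + \<bar>Im (fst p) - Im (fst q)\<bar> + \<bar>snd p - snd q\<bar>"
proof -
  have "dist p q \<le> dist (fst p) (fst q) + dist (snd p) (snd q)"
    unfolding dist_prod_def by (rule sqrt_sum_squares_le_sum) auto
  then show ?thesis
    using cmod_le[of "fst p - fst q"] by (auto simp: dist_norm)
qed

text \<open>Keeps the union bound over cells a finite sum.\<close>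

lemma finite_grid_cell_image:
  assumes "bounded S"
  shows "finite (grid_cell r ` S)"
proof -
  obtain c where c: "\<And>p. p \<in> S \<Longrightarrow> dist 0 p \<le> c"
    using assms bounded_any_center by metis
  have "grid_cell r ` S \<subseteq> {\<lfloor>- \<bar>c / r\<bar>\<rfloor>..\<lfloor>\<bar>c / r\<bar>\<rfloor>} \<times> {\<lfloor>- \<bar>c / r\<bar>\<rfloor>..\<lfloor>\<bar>c / r\<bar>\<rfloor>} \<times>
      {\<lfloor>- \<bar>c / r\<bar>\<rfloor>..\<lfloor>\<bar>c / r\<bar>\<rfloor>}"
  proof (rule image_subsetI)
    fix p assume "p \<in> S"
    have *: "\<lfloor>a / r\<rfloor> \<in> {\<lfloor>- \<bar>c / r\<bar>\<rfloor>..\<lfloor>\<bar>c / r\<bar>\<rfloor>}" if "\<bar>a\<bar> \<le> c" for a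
    proof -
      have "\<bar>a / r\<bar> \<le> \<bar>c / r\<bar>" using that by (simp add: abs_divide divide_right_mono)
      then have "- \<bar>c / r\<bar> \<le> a / r" "a / r \<le> \<bar>c / r\<bar>" by linarith+
      then show ?thesis by (auto intro: floor_mono)
    qed
    show "grid_cell r p \<in> {\<lfloor>- \<bar>c / r\<bar>\<rfloor>..\<lfloor>\<bar>c / r\<bar>\<rfloor>} \<times> {\<lfloor>- \<bar>c / r\<bar>\<rfloor>..\<lfloor>\<bar>c / r\<bar>\<rfloor>} \<times>
      {\<lfloor>- \<bar>c / r\<bar>\<rfloor>..\<lfloor>\<bar>c / r\<bar>\<rfloor>}"
      using c[OF \<open>p \<in> S\<close>] coordinate_diff_le_dist[of 0 p] unfolding grid_cell_def
      by (intro SigmaI *) auto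
  qed
  then show ?thesis by (rule finite_subset) auto
qed

lemma floor_diff_adjacent:
  fixes a b r :: real
  assumes "\<bar>a - b\<bar> < r"
  shows "\<lfloor>b / r\<rfloor> - \<lfloor>a / r\<rfloor> \<in> {-1..1}"
proof -
  have r: "r > 0" using assms by linarith
  have "\<bar>a / r - b / r\<bar> < 1"
    using r assms by (simp add: abs_divide flip: diff_divide_distrib)
  then show ?thesis unfolding atLeastAtMost_iff by linarith
qed

lemma diff_lt_of_floor_adjacent:
  fixes a b r :: real
  assumes r: "r > 0" and "\<lfloor>b / r\<rfloor> - \<lfloor>a / r\<rfloor> \<in> {-1..1}"
  shows "\<bar>a - b\<bar> < 2 * r"
proof -
  have "\<bar>a / r - b / r\<bar> < 2"
    using assms(2) unfolding atLeastAtMost_iff by linarith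
  then show ?thesis
    using r by (simp add: abs_divide field_simps flip: diff_divide_distrib)
qed

text \<open>Moving by less than one side length changes each floor by at most 1. Hence a ball whose
  radius is the side length has at most the measure of the block around its centre.\<close>

lemma adjacent_of_dist_lt:
  assumes "dist p q < r"
  shows "grid_cell r q - grid_cell r p \<in> adjacent"
  using assms coordinate_diff_le_dist[of p q]
  unfolding grid_cell_def adjacent_def minus_prod_def fst_conv snd_conv
  by (intro SigmaI floor_diff_adjacent) auto

lemma dist_lt_of_adjacent:
  assumes "r > 0" and "grid_cell r q - grid_cell r p \<in> adjacent"
  shows "dist p q < 8 * r"
proof -
  have "\<bar>Re (fst p) - Re (fst q)\<bar> < 2 * r" "\<bar>Im (fst p) - Im (fst q)\<bar> < 2 * r"
    "\<bar>snd p - snd q\<bar> < 2 * r"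
    using assms unfolding grid_cell_def adjacent_def minus_prod_def fst_conv snd_conv
    by (auto intro!: diff_lt_of_floor_adjacent simp del: atLeastAtMost_iff)
  \<comment> \<open>The coordinates add up to less than \<open>6 * r\<close>, which is rounded up to
    a power of two times \<open>r\<close>.\<close>
  then show ?thesis
    using dist_le_coordinate_diffs[of p q] assms(1) by linarith
qed

section \<open>Embedding the Julia set into three-dimensional space\<close>

text \<open>Puts the chordal and the Euclidean case of \<open>dist_on\<close> into the same space,
  so that one grid serves both: either the unit sphere or a horizontal plane.\<close>

definition embed :: "sphere set \<Rightarrow> sphere \<Rightarrow> complex \<times> real" where
  "embed J z = (if Infty \<in> J then stereo z else (to_complex z, 0))"

lemma dist_on_embed: "dist_on J z w = dist (embed J z) (embed J w)"
  by (simp add: dist_on_def embed_def chordal_stereo dist_norm)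

text \<open>At \<^term>\<open>Infty\<close> both sides are \<open>0\<close>, since \<open>0 / 0 = 0\<close>.\<close>

lemma to_complex_stereo: "to_complex z = fst (stereo z) / of_real (1 - snd (stereo z))"
proof (cases z)
  case (Fin a)
  define s where "s = 2 / (1 + (cmod a)\<^sup>2)"
  have p: "1 + (cmod a)\<^sup>2 > 0" by (rule add_pos_nonneg) auto
  have "1 - snd (stereo z) = s" using p Fin by (simp add: s_def field_simps)
  moreover have "fst (stereo z) = of_real s * a" using Fin by (simp add: s_def)
  moreover have "s \<noteq> 0" using p by (simp add: s_def)
  ultimately show ?thesis using Fin by simp
qed simp

lemma borel_measurable_embed: "embed J \<in> borel_measurable borel"
proof -
  have "continuous_on UNIV stereo"
    by (auto simp: continuous_on_iff dist_sphere_def simp flip: chordal_stereo)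
  then have [measurable]: "stereo \<in> borel_measurable borel"
    by (rule borel_measurable_continuous_onI)
  have [measurable]: "fst \<in> borel_measurable (borel :: (complex \<times> real) measure)"
    "snd \<in> borel_measurable (borel :: (complex \<times> real) measure)"
    by (auto intro!: borel_measurable_continuous_onI continuous_intros)
  \<comment> \<open>The junk value makes \<open>to_complex\<close> discontinuous at
    \<open>Infty\<close>; as a quotient of coordinates of \<open>stereo\<close> it is still
    Borel.\<close>
  have [measurable]: "to_complex \<in> borel_measurable borel"
    unfolding to_complex_stereo[abs_def] by measurable
  show ?thesis
    unfolding embed_def[abs_def] by measurable
qed

text \<open>The sphere is bounded. In the planar case a closed \<open>J\<close> missing
  \<open>Infty\<close> keeps some chordal distance \<open>e\<close> from it, and since
  \<open>Fin a\<close> is at distance \<open>2 / sqrt (1 + (cmod a)\<^sup>2)\<close> from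
  \<open>Infty\<close>, this bounds \<open>cmod a\<close>.\<close>

lemma bounded_embed_image:
  assumes "closed J"
  shows "bounded (embed J ` J)"
proof (cases "Infty \<in> J")
  case True
  have "dist (stereo Infty) (stereo z) \<le> 2" for z
  proof (cases z)
    case (Fin a)
    have "1 \<le> sqrt (1 + (cmod a)\<^sup>2)" by simp
    then show ?thesis
      unfolding chordal_stereo[symmetric] Fin chordal.simps
      by (subst pos_divide_le_eq) linarith+
  qed auto
  with True show ?thesis by (auto simp: bounded_def embed_def)
next
  case False
  then obtain e where e: "e > 0" "\<And>z. dist z Infty < e \<Longrightarrow> z \<notin> J"
    using open_dist[of "- J"] assms by (auto simp: open_Compl)
  have "cmod (to_complex z) \<le> 2 / e" if "z \<in> J" for z
  proof (cases z)
    case (Fin a)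
    have "cmod a \<le> sqrt (1 + (cmod a)\<^sup>2)" by (rule real_le_rsqrt) simp
    moreover have "e \<le> 2 / sqrt (1 + (cmod a)\<^sup>2)"
      using e(2)[of z] that Fin by (fastforce simp: dist_sphere_def not_less[symmetric])
    moreover have "0 < sqrt (1 + (cmod a)\<^sup>2)" by (simp add: add_pos_nonneg)
    ultimately have "e * cmod a \<le> 2"
      using e(1) by (smt (verit) mult_left_mono pos_le_divide_eq)
    then show ?thesis using e(1) Fin by (simp add: field_simps)
  qed (use e in simp)
  with False show ?thesis
    by (auto simp: bounded_iff embed_def norm_Pair)
qed

section \<open>Upper and lower limits under rescaling of the radius\<close>

text \<open>The substitution of \<open>C * r\<close> for \<open>r\<close> preserves the filter
  \<open>at_right 0\<close>, so a constant factor in the radius does not change either limit, and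
  the loss \<open>e\<close> is arbitrary.\<close>

lemma Limsup_Liminf_mono_scaled:
  fixes f g :: "real \<Rightarrow> ereal"
  assumes C: "C > 0"
    and fg: "\<And>(c::real) (e::real). (0::real) < e \<Longrightarrow>
      eventually (\<lambda>r. g r < ereal c \<longrightarrow> f (C * r) \<le> ereal (c + e)) (at_right 0)"
  shows "Limsup (at_right 0) f \<le> Limsup (at_right 0) g"
    and "Liminf (at_right 0) f \<le> Liminf (at_right 0) g"
proof -
  have scale: "eventually (\<lambda>r. P (C * r)) (at_right 0) \<longleftrightarrow> eventually P (at_right (0::real))" for P
    using eventually_filtermap[of P "\<lambda>r. C * r" "at_right 0"] filtermap_times_pos_at_right[OF C, of 0]
    by (simp add: o_def)
  \<comment> \<open>Real thresholds \<open>c\<close> avoid arithmetic with infinite limits; for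
    \<open>y = \<infinity>\<close> there is no such \<open>c\<close> and nothing to prove.\<close>
  have le: "x \<le> y" if that: "\<And>(c::real) (e::real). y < ereal c \<Longrightarrow> (0::real) < e \<Longrightarrow> x \<le> ereal (c + e)" for x y :: ereal
  proof (rule ereal_le_real)
    fix c :: real assume c: "y \<le> ereal c"
    show "x \<le> ereal c"
    proof (rule ereal_le_epsilon2)
      fix e :: real assume e: "e > 0"
      then have "y < ereal (c + e / 2)"
        by (intro le_less_trans[OF c]) simp
      from that[OF this, of "e / 2"] e show "x \<le> ereal c + ereal e" by (simp add: add.commute)
    qed
  qed
  show "Limsup (at_right 0) f \<le> Limsup (at_right 0) g"
  proof (rule le)
    fix c e :: real assume c: "Limsup (at_right 0) g < ereal c" and e: "0 < e"
    have "eventually (\<lambda>r. g r < ereal c) (at_right 0)" using c by (rule Limsup_lessD)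
    with fg[OF e, of c] have "eventually (\<lambda>r. f (C * r) \<le> ereal (c + e)) (at_right 0)"
      by eventually_elim auto
    then have "eventually (\<lambda>r. f r \<le> ereal (c + e)) (at_right 0)"
      using scale[of "\<lambda>r. f r \<le> ereal (c + e)"] by simp
    then show "Limsup (at_right 0) f \<le> ereal (c + e)" by (simp add: Limsup_bounded)
  qed
  show "Liminf (at_right 0) f \<le> Liminf (at_right 0) g"
  \<comment> \<open>If \<open>f\<close> eventually exceeds \<open>c + e\<close>, the contrapositive
    of \<open>fg\<close> keeps \<open>g\<close> eventually at or above \<open>c\<close>, against the
    choice of \<open>c\<close>.\<close>
  proof (rule le, rule ccontr)
    fix c e :: real assume c: "Liminf (at_right 0) g < ereal c" and e: "0 < e"
      and n: "\<not> Liminf (at_right 0) f \<le> ereal (c + e)"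
    then have "eventually (\<lambda>r. f r > ereal (c + e)) (at_right 0)"
      by (intro less_LiminfD) simp
    then have "eventually (\<lambda>r. f (C * r) > ereal (c + e)) (at_right 0)"
      using scale[of "\<lambda>r. f r > ereal (c + e)"] by simp
    with fg[OF e, of c] have "eventually (\<lambda>r. ereal c \<le> g r) (at_right 0)"
      by eventually_elim auto
    then have "ereal c \<le> Liminf (at_right 0) g" by (rule Liminf_bounded)
    with c show False by simp
  qed
qed

section \<open>Almost sure quick returns at dyadic scales\<close>

lemma nbhd_in_sets:
  assumes "sets M = sets (restrict_space borel J)"
  shows "nbhd J r z \<in> sets M"
proof -
  have "(\<lambda>w. dist (embed J z) (embed J w)) \<in> borel_measurable borel"
    using borel_measurable_embed[of J] by measurable
  then have "(\<lambda>w. dist (embed J z) (embed J w)) \<in> borel_measurable (restrict_space borel J)"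
    by (rule measurable_restrict_space1)
  then have "{w \<in> space (restrict_space borel J). dist (embed J z) (embed J w) < r} \<in> sets M"
    unfolding assms by measurable
  then show ?thesis
    by (simp add: nbhd_def dist_on_embed space_restrict_space)
qed

text \<open>The choice \<open>t = 2 powr (e * n)\<close> makes the exceptional sets summable as a
  geometric series, and costs only \<open>e\<close> in the exponent.\<close>

lemma quick_return_AE:
  fixes e :: real
  assumes M: "prob_space M" "sets M = sets (restrict_space borel J)" and J: "closed J"
    and T: "T \<in> M \<rightarrow>\<^sub>M M" and inv: "distr M M T = M" and e: "e > 0"
  shows "AE z in M. \<forall>\<^sub>F n in sequentially. \<exists>k>0. (T ^^ k) z \<in> nbhd J (8 / 2 ^ n) z \<and>
      k * measure M (nbhd J (1 / 2 ^ n) z) \<le> 2 powr (e * n)"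
proof -
  interpret prob_space M by fact
  have space: "space M = J"
    using sets_eq_imp_space_eq[OF M(2)] by (simp add: space_restrict_space)
  define K where "K n = (\<lambda>z. grid_cell (1 / 2 ^ n) (embed J z))" for n :: nat
  have K: "K n \<in> M \<rightarrow>\<^sub>M count_space UNIV" for n
    unfolding measurable_cong_sets[OF M(2) refl] K_def
    by (intro measurable_restrict_space1 measurable_compose[OF borel_measurable_embed measurable_grid_cell])
  have fin: "finite (K n ` space M)" for n
    using finite_grid_cell_image[OF bounded_embed_image[OF J], of "1 / 2 ^ n"]
    unfolding space K_def image_image .
  define quick where "quick n x \<longleftrightarrow> (\<exists>k>0. K n ((T ^^ k) x) - K n x \<in> adjacent \<and>
      k * prob {y\<in>space M. K n y - K n x \<in> adjacent} \<le> 2 powr (e * n))" for n :: nat and x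
  have "\<exists>B. B \<in> events \<and> prob B \<le> card adjacent / 2 powr (e * n) \<and>
      (\<forall>x\<in>space M - B. quick n x)" for n :: nat
  proof (rule quick_return_outside_small_set[OF T inv K fin finite_adjacent zero_in_adjacent])
    show "0 < 2 powr (e * n)" by simp
  next
    fix B
    assume "B \<in> events" "prob B \<le> card adjacent / 2 powr (e * n)"
      "\<And>x. x \<in> space M - B \<Longrightarrow> \<exists>k>0. K n ((T ^^ k) x) - K n x \<in> adjacent \<and>
        k * prob {y\<in>space M. K n y - K n x \<in> adjacent} \<le> 2 powr (e * n)"
    then show ?thesis unfolding quick_def by (intro exI[of _ B] conjI ballI)
  qed
  then obtain B :: "nat \<Rightarrow> sphere set" where B: "\<And>n. B n \<in> events"
    and B_le: "\<And>n. prob (B n) \<le> card adjacent / 2 powr (e * n)"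
    and ret: "\<And>n x. x \<in> space M - B n \<Longrightarrow> quick n x"
    by metis
  have "summable (\<lambda>n. prob (B n))"
  proof (rule summable_comparison_test')
    have "summable (\<lambda>n. card adjacent * (2 powr - e) ^ n)"
      using e by (intro summable_mult summable_geometric) (auto simp: powr_less_one)
    moreover have "card adjacent * (2 powr - e) ^ n = card adjacent / 2 powr (e * n)" for n
      by (subst powr_power) (simp_all add: powr_minus divide_inverse mult.commute)
    ultimately show "summable (\<lambda>n. card adjacent / 2 powr (e * n))" by simp
    show "norm (prob (B n)) \<le> card adjacent / 2 powr (e * n)" for n
      using B_le[of n] by simp
  qed
  then have "AE z in M. \<forall>\<^sub>F n in sequentially. z \<in> space M - B n"
    using B by (intro borel_cantelli_AE1) (auto simp: emeasure_eq_measure)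
  then show ?thesis
  proof (rule AE_mp, intro AE_I2 impI)
    fix z assume z: "z \<in> space M" and ev: "\<forall>\<^sub>F n in sequentially. z \<in> space M - B n"
    show "\<forall>\<^sub>F n in sequentially. \<exists>k>0. (T ^^ k) z \<in> nbhd J (8 / 2 ^ n) z \<and>
      k * measure M (nbhd J (1 / 2 ^ n) z) \<le> 2 powr (e * n)"
      using ev
    proof eventually_elim
      case (elim n)
      from ret[OF this] obtain k where k: "k > 0" "K n ((T ^^ k) z) - K n z \<in> adjacent"
        "k * prob {y\<in>space M. K n y - K n z \<in> adjacent} \<le> 2 powr (e * n)" unfolding quick_def by blast
      have "(T ^^ k) z \<in> J"
        using measurable_space[OF measurable_funpow[OF T] z] space by simp
      with k(2) have "(T ^^ k) z \<in> nbhd J (8 / 2 ^ n) z"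
        using dist_lt_of_adjacent[of "1 / 2 ^ n"] by (auto simp: nbhd_def K_def dist_on_embed)
      \<comment> \<open>The return bound involves the measure of the block; it passes to the smaller
        ball inside.\<close>
      moreover have "prob (nbhd J (1 / 2 ^ n) z) \<le> prob {y\<in>space M. K n y - K n z \<in> adjacent}"
      proof (rule finite_measure_mono)
        show "nbhd J (1 / 2 ^ n) z \<subseteq> {y \<in> space M. K n y - K n z \<in> adjacent}"
          by (auto intro!: adjacent_of_dist_lt simp: nbhd_def K_def dist_on_embed space)
        show "{y \<in> space M. K n y - K n z \<in> adjacent} \<in> events"
          using measurable_sets[OF K, of "{i. i - K n z \<in> adjacent}" n]
          by (simp add: vimage_def Int_def conj_commute)
      qed
      then have "k * prob (nbhd J (1 / 2 ^ n) z) \<le> k * prob {y\<in>space M. K n y - K n z \<in> adjacent}"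
        by (rule mult_left_mono) simp
      ultimately show ?case using k by (meson order.trans)
    qed
  qed
qed

section \<open>From dyadic radii to the recurrence rates\<close>

lemma dyadic_scale:
  fixes \<rho> :: real
  assumes "0 < \<rho>" "\<rho> \<le> 1 / 2 ^ m"
  obtains n where "n \<ge> m" "\<rho> \<le> 1 / 2 ^ n" "1 / 2 ^ n < 2 * \<rho>"
proof
  define n where "n = nat \<lfloor>log 2 (1 / \<rho>)\<rfloor>"
  have "2 ^ m \<le> 1 / \<rho>" using assms by (simp add: field_simps)
  then have m: "real m \<le> log 2 (1 / \<rho>)"
    using assms by (simp add: le_log_iff powr_realpow)
  then show "m \<le> n" unfolding n_def by linarith
  have n: "real n \<le> log 2 (1 / \<rho>)" "log 2 (1 / \<rho>) < real (Suc n)"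
    using m unfolding n_def by linarith+
  from n(1) have "2 ^ n \<le> 1 / \<rho>"
    using assms by (simp add: le_log_iff powr_realpow)
  then show "\<rho> \<le> 1 / 2 ^ n" using assms by (simp add: field_simps)
  from n(2) have "1 / \<rho> < 2 ^ Suc n"
    using assms by (subst (asm) log_less_iff) (auto simp: powr_realpow simp del: power_Suc of_nat_Suc)
  then show "1 / 2 ^ n < 2 * \<rho>" using assms by (simp add: field_simps)
qed

lemma ln_ext_mono: "x \<le> y \<Longrightarrow> ln_ext x \<le> ln_ext y"
  by (cases x; cases y) (auto simp: ln_ext_def)

text \<open>Logarithms turn \<open>k * \<mu> \<le> (1 / r) powr \<eta>\<close> into
  \<open>ln k \<le> - ln \<mu> + \<eta> * - ln r\<close>, and the dimension hypothesis bounds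
  \<open>- ln \<mu>\<close> by \<open>c * - ln r\<close>. The gap between \<open>\<eta>\<close> and
  \<open>e\<close> absorbs the factor 16 in the radius.\<close>

lemma recurrence_rate_estimate:
  fixes c e \<eta> :: real
  assumes M: "finite_measure M" "sets M = sets (restrict_space borel (julia T))"
    and \<eta>: "\<eta> > 0" "\<eta> < e"
    and ret: "\<forall>\<^sub>F n in sequentially. \<exists>k>0. (T ^^ k) z \<in> nbhd (julia T) (8 / 2 ^ n) z \<and>
      k * measure M (nbhd (julia T) (1 / 2 ^ n) z) \<le> 2 powr (\<eta> * n)"
  shows "\<forall>\<^sub>F r in at_right 0.
      ln_ext (ereal (measure M (nbhd (julia T) r z))) / ereal (ln r) < ereal c \<longrightarrow>
      ln_ext (ereal_of_enat (recurrence_time T (16 * r) z)) / ereal (- ln (16 * r)) \<le> c + e"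
proof -
  interpret finite_measure M by fact
  let ?J = "julia T"
  obtain m where m: "\<And>n. n \<ge> m \<Longrightarrow> \<exists>k>0. (T ^^ k) z \<in> nbhd ?J (8 / 2 ^ n) z \<and>
      k * measure M (nbhd ?J (1 / 2 ^ n) z) \<le> 2 powr (\<eta> * n)"
    using ret unfolding eventually_sequentially by blast
  have "\<forall>\<^sub>F r in at_right 0. (0::real) < r" by (rule eventually_at_right_less)
  moreover have "\<forall>\<^sub>F r in at_right 0. r < (1::real) / 2 ^ m"
    by (rule order_tendstoD[OF tendsto_ident_at]) simp
  \<comment> \<open>Makes the denominator \<open>- ln (16 * r)\<close> positive.\<close>
  moreover have "\<forall>\<^sub>F r in at_right 0. r < (1::real) / 16"
    by (rule order_tendstoD[OF tendsto_ident_at]) simp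
  \<comment> \<open>This threshold is
    \<open>(c + \<eta>) * - ln r \<le> (c + e) * - ln (16 * r)\<close> solved for
    \<open>ln r\<close>.\<close>
  moreover have "\<forall>\<^sub>F r in at_right (0::real). ln r \<le> - ((c + e) * ln 16 / (e - \<eta>))"
    using ln_at_0 unfolding filterlim_at_bot by blast
  ultimately show ?thesis
  proof (eventually_elim, intro impI)
    fix r :: real
    assume r: "0 < r" "r < 1 / 2 ^ m" "r < 1 / 16" and L: "ln r \<le> - ((c + e) * ln 16 / (e - \<eta>))"
      and dim: "ln_ext (ereal (measure M (nbhd ?J r z))) / ereal (ln r) < ereal c"
    define \<mu> where "\<mu> = measure M (nbhd ?J r z)"
    have lnr: "ln r < 0" using r by simp
    have ln16: "ln (16 * r) = ln 16 + ln r" using r by (simp add: ln_mult)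
    have neg: "ln (16 * r) < 0" using r by (subst ln_less_zero_iff) auto
    \<comment> \<open>For a null ball the quotient is \<open>-\<infinity>\<close> divided by a
      negative number, hence \<open>\<infinity>\<close>, which is not below
      \<open>c\<close>.\<close>
    have \<mu>: "\<mu> > 0"
    proof (rule ccontr)
      assume "\<not> \<mu> > 0"
      then have "ln_ext (ereal \<mu>) / ereal (ln r) = \<infinity>"
        using lnr by (simp add: ln_ext_def divide_ereal_def)
      with dim show False unfolding \<mu>_def by simp
    qed
    then have "ln \<mu> / ln r < c"
      using dim lnr unfolding \<mu>_def by (simp add: ln_ext_def)
    then have ln\<mu>: "- ln \<mu> < c * - ln r"
      using lnr by (simp add: field_simps)
    \<comment> \<open>The first inequality puts the \<open>r\<close>-ball inside the ball of radius
      \<open>1 / 2 ^ n\<close>; the second puts the return radius \<open>8 / 2 ^ n\<close> below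
      \<open>16 * r\<close>.\<close>
    obtain n where n: "n \<ge> m" "r \<le> 1 / 2 ^ n" "1 / 2 ^ n < 2 * r"
      using dyadic_scale[of r m] r by auto
    obtain k where k: "k > 0" "(T ^^ k) z \<in> nbhd ?J (8 / 2 ^ n) z"
      "k * measure M (nbhd ?J (1 / 2 ^ n) z) \<le> 2 powr (\<eta> * n)"
      using m[OF n(1)] by blast
    have "\<mu> \<le> measure M (nbhd ?J (1 / 2 ^ n) z)"
      unfolding \<mu>_def using n(2)
      by (intro finite_measure_mono nbhd_in_sets[OF M(2)]) (auto simp: nbhd_def)
    then have "k * \<mu> \<le> k * measure M (nbhd ?J (1 / 2 ^ n) z)"
      by (rule mult_left_mono) simp
    also note k(3)
    also have "2 powr (\<eta> * n) = (2 ^ n) powr \<eta>"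
      by (simp add: powr_realpow[symmetric] powr_powr mult.commute)
    also have "\<dots> \<le> (1 / r) powr \<eta>"
      using n(2) r \<eta> by (intro powr_mono2) (auto simp: field_simps)
    finally have "ln (k * \<mu>) \<le> ln ((1 / r) powr \<eta>)"
      using k(1) \<mu> by (intro ln_mono) auto
    then have "ln k \<le> - ln \<mu> + \<eta> * - ln r"
      using k(1) \<mu> r by (simp add: ln_mult ln_powr ln_div)
    also have "\<dots> \<le> (c + \<eta>) * - ln r"
      using ln\<mu> by (simp add: algebra_simps)
    also have "\<dots> \<le> (c + e) * - ln (16 * r)"
    proof -
      have "(c + e) * ln 16 / (e - \<eta>) \<le> - ln r" using L by simp
      then have "(c + e) * ln 16 \<le> - ln r * (e - \<eta>)"
        using \<eta> by (simp add: pos_divide_le_eq)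
      then show ?thesis unfolding ln16 by (simp add: algebra_simps)
    qed
    finally have lnk: "ln k / - ln (16 * r) \<le> c + e"
      using neg by (subst pos_divide_le_eq) auto
    have "(T ^^ k) z \<in> nbhd ?J (16 * r) z"
      using k(2) n(3) by (auto simp: nbhd_def)
    then have "recurrence_time T (16 * r) z \<le> enat k"
      using k(1) unfolding recurrence_time_def by (intro Inf_lower) auto
    then have "ereal_of_enat (recurrence_time T (16 * r) z) \<le> ereal (real k)"
      by (metis ereal_of_enat_le_iff ereal_of_enat_simps(1))
    then have "ln_ext (ereal_of_enat (recurrence_time T (16 * r) z)) \<le> ln_ext (ereal (real k))"
      by (rule ln_ext_mono)
    also have "\<dots> = ereal (ln k)" using k(1) by (simp add: ln_ext_def)
    finally have "ln_ext (ereal_of_enat (recurrence_time T (16 * r) z)) / ereal (- ln (16 * r)) \<le>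
        ereal (ln k) / ereal (- ln (16 * r))"
      using neg by (intro ereal_divide_right_mono) auto
    also have "\<dots> \<le> ereal (c + e)"
      using neg lnk by simp
    finally show "ln_ext (ereal_of_enat (recurrence_time T (16 * r) z)) / ereal (- ln (16 * r)) \<le> c + e" .
  qed
qed

theorem theorem1:
  fixes T :: "sphere \<Rightarrow> sphere" and d :: nat and M :: "sphere measure"
  assumes "rational_map d T" and "d \<ge> 2" and "hyperbolic T"
    and "prob_space M" and "sets M = sets (restrict_space borel (julia T))"
    and "nonatomic M" and "invariant_measure T M"
  shows "AE z in M.
      lower_recurrence_rate T z \<le> lower_local_dim (julia T) M z \<and>
      upper_recurrence_rate T z \<le> upper_local_dim (julia T) M z"
proof -
  interpret prob_space M by fact
  have T: "T \<in> M \<rightarrow>\<^sub>M M" "distr M M T = M"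
    using assms(7) by (auto simp: invariant_measure_def)
  \<comment> \<open>Only countably many exponents can share one null set. The values
    \<open>inverse (real (Suc j))\<close> suffice, since some of them lies below any given
    \<open>e > 0\<close>.\<close>
  have "AE z in M. \<forall>j. \<forall>\<^sub>F n in sequentially. \<exists>k>0. (T ^^ k) z \<in> nbhd (julia T) (8 / 2 ^ n) z \<and>
      k * measure M (nbhd (julia T) (1 / 2 ^ n) z) \<le> 2 powr (inverse (real (Suc j)) * n)"
    unfolding AE_all_countable
    by (intro allI quick_return_AE[OF assms(4,5) _ T]) (simp_all add: julia_def)
  then show ?thesis
  proof (rule AE_mp, intro AE_I2 impI)
    fix z
    assume ret: "\<forall>j. \<forall>\<^sub>F n in sequentially. \<exists>k>0. (T ^^ k) z \<in> nbhd (julia T) (8 / 2 ^ n) z \<and>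
      k * measure M (nbhd (julia T) (1 / 2 ^ n) z) \<le> 2 powr (inverse (real (Suc j)) * n)"
    have "\<forall>\<^sub>F r in at_right 0.
        ln_ext (ereal (measure M (nbhd (julia T) r z))) / ereal (ln r) < ereal c \<longrightarrow>
        ln_ext (ereal_of_enat (recurrence_time T (16 * r) z)) / ereal (- ln (16 * r)) \<le> c + e"
      if "e > 0" for c e :: real
    proof -
      obtain j where j: "inverse (real (Suc j)) < e" using reals_Archimedean[OF \<open>e > 0\<close>] by blast
      show ?thesis
        by (rule recurrence_rate_estimate[OF finite_measure_axioms assms(5) _ j ret[rule_format]]) simp
    qed
    from Limsup_Liminf_mono_scaled[where C = 16
        and f = "\<lambda>r. ln_ext (ereal_of_enat (recurrence_time T r z)) / ereal (- ln r)"
        and g = "\<lambda>r. ln_ext (ereal (measure M (nbhd (julia T) r z))) / ereal (ln r)", OF _ this]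
    show "lower_recurrence_rate T z \<le> lower_local_dim (julia T) M z \<and>
      upper_recurrence_rate T z \<le> upper_local_dim (julia T) M z"
      unfolding lower_recurrence_rate_def lower_local_dim_def
        upper_recurrence_rate_def upper_local_dim_def by simp
  qed
qed

end
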